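(* For every $n\ge 0$, the number of simsun permutations of length $n$ that avoid the pattern $132$ is the secondary structure number $S_n$: $$|\mathcal{RS}_n(132)|=S_n.$$
   Context: $\mathfrak{S}_n$ is the set of permutations of $\{1,\dots,n\}$, written in one-line notation $\pi=\pi_1\pi_2\dots\pi_n$ ($\mathfrak{S}_0$ consists of the empty permutation). A permutation $\pi\in\mathfrak{S}_n$ is simsun if for every $3\le k\le n$, the subword of $\pi_1\pi_2\dots\pi_n$ consisting of the entries in $\{1,\dots,k\}$ (kept in their order) has no double descent, i.e. no three entries that are consecutive in that subword and in decreasing order. A permutation $\pi\in\mathfrak{S}_n$ avoids the pattern $\sigma\in\mathfrak{S}_k$ if there are no indices $i_1<i_2<\dots<i_k$ such that $\pi_{i_1}\pi_{i_2}\dots\pi_{i_k}$ is in the same relative order as $\sigma$. $\mathcal{RS}_n(\sigma)$ is the set of simsun permutations in $\mathfrak{S}_n$ avoiding $\sigma$. The secondary structure numbers $S_n$ (not to be confused with $\mathfrak{S}_n$) are the integers defined by the formal power series identity $$\sum_{n\ge0} S_n z^n = \frac{1-z-z^2-\sqrt{1-2z-z^2-2z^3+z^4}}{2z^3}$$ (so $S_0,S_1,S_2,\dots=1,1,2,4,8,17,\dots$). *)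

theory Defs
  imports
    Complex_Main
    "HOL-Combinatorics.Combinatorics"
    "HOL-Computational_Algebra.Formal_Power_Series"
begin

text \<open>
  A permutation of \<open>{1..n}\<close> is given by its one-line notation, i.e. it is an element of
  \<^term>\<open>permutations_of_set {1..n}\<close>. List positions are counted from 0.
\<close>

definition has_double_descent :: "nat list \<Rightarrow> bool" where
  "has_double_descent w \<longleftrightarrow>
     (\<exists>i. i + 2 < length w \<and> w ! i > w ! (i + 1) \<and> w ! (i + 1) > w ! (i + 2))"

definition simsun :: "nat list \<Rightarrow> bool" where
  "simsun w \<longleftrightarrow>
     (\<forall>k. 3 \<le> k \<and> k \<le> length w \<longrightarrow> \<not> has_double_descent (filter (\<lambda>x. x \<in> {1..k}) w))"

definition contains_pattern :: "nat list \<Rightarrow> nat list \<Rightarrow> bool" where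
  "contains_pattern w \<sigma> \<longleftrightarrow>
     (\<exists>i :: nat \<Rightarrow> nat. strict_mono_on {..<length \<sigma>} i \<and>
        (\<forall>a < length \<sigma>. i a < length w) \<and>
        (\<forall>a < length \<sigma>. \<forall>b < length \<sigma>. w ! i a < w ! i b \<longleftrightarrow> \<sigma> ! a < \<sigma> ! b))"

definition RS :: "nat \<Rightarrow> nat list \<Rightarrow> nat list set" where
  "RS n \<sigma> = {\<pi> \<in> permutations_of_set {1..n}. simsun \<pi> \<and> \<not> contains_pattern \<pi> \<sigma>}"

text \<open>
  The square root is the power series root with constant term 1. Division of power series
  truncates when it is not exact; here it is exact, as shown in \<open>secondary_structure_gf\<close> below.
\<close>

abbreviation secondary_structure_sqrt :: "real fps" where
  "secondary_structure_sqrt \<equiv>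
     fps_radical (\<lambda>k. root k) 2 (1 - 2 * fps_X - fps_X ^ 2 - 2 * fps_X ^ 3 + fps_X ^ 4)"

definition secondary_structure_number :: "nat \<Rightarrow> real" where
  "secondary_structure_number n =
     fps_nth ((1 - fps_X - fps_X ^ 2 - secondary_structure_sqrt) / (2 * fps_X ^ 3)) n"

lemma secondary_structure_sqrt_square:
  "secondary_structure_sqrt ^ 2 = 1 - 2 * fps_X - fps_X ^ 2 - 2 * fps_X ^ 3 + fps_X ^ 4"
  using power_radical[of "1 - 2 * fps_X - fps_X ^ 2 - 2 * fps_X ^ 3 + fps_X ^ 4 :: real fps"
      "\<lambda>k. root k" 1]
  by (simp add: numeral_2_eq_2)

lemma secondary_structure_gf:
  includes fps_syntax
  shows
  "Abs_fps secondary_structure_number * (2 * fps_X ^ 3) =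
     1 - fps_X - fps_X ^ 2 - secondary_structure_sqrt"
proof -
  define R where "R = secondary_structure_sqrt"
  define N where "N = 1 - fps_X - fps_X ^ 2 - R"
  have sq: "R * R = 1 - 2 * fps_X - fps_X ^ 2 - 2 * fps_X ^ 3 + fps_X ^ 4"
    using secondary_structure_sqrt_square unfolding R_def power2_eq_square[of "fps_radical _ _ _"] .
  have nth: "(2 * fps_X ^ k :: real fps) $ n = (if n = k then 2 else 0)" for k n
    by (simp add: numeral_fps_const)
  have R0: "R $ 0 = 1"
    by (simp add: R_def)
  have nth1: "(2 * fps_X :: real fps) $ n = (if n = 1 then 2 else 0)" for n
    using nth[of 1 n] by simp
  have "(R * R) $ 1 = -2" "(R * R) $ 2 = -1"
    unfolding sq fps_sub_nth fps_add_nth nth nth1 by (simp_all add: fps_X_power_nth)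
  then have R1: "R $ 1 = -1" and R2: "R $ 2 = -1"
    by (simp_all add: fps_mult_nth R0 numeral_2_eq_2)
  have N: "N $ n = 0" if "n < 3" for n
  proof -
    from that consider "n = 0" | "n = 1" | "n = 2" by linarith
    then show ?thesis
      by cases (simp_all add: N_def R0 R1[simplified] R2 fps_X_power_nth)
  qed
  have shift: "N = fps_X ^ 3 * fps_shift 3 N"
    using N by (auto simp: fps_eq_iff fps_X_power_mult_nth)
  have half: "2 * fps_const (1 / 2) = (1 :: real fps)"
    by (simp add: numeral_fps_const)
  have "N = 2 * fps_const (1 / 2) * (fps_X ^ 3 * fps_shift 3 N)"
    unfolding half using shift by simp
  then have "N = 2 * fps_X ^ 3 * (fps_const (1 / 2) * fps_shift 3 N)"
    by (simp only: mult_ac)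
  then have "2 * fps_X ^ 3 dvd N"
    by (rule dvdI)
  moreover have "Abs_fps secondary_structure_number = N / (2 * fps_X ^ 3)"
    by (simp add: fps_eq_iff secondary_structure_number_def N_def R_def)
  ultimately show ?thesis
    by (simp add: N_def R_def)
qed

end

theory Submission
  imports Defs
begin

text \<open>
  In a permutation avoiding 132, every entry to the left of the maximum exceeds every entry to
  the right of it, and both sides avoid 132 again. Splitting at the maximum recursively therefore
  turns these permutations into binary trees (\<open>perm_of\<close>, with \<open>inj_perm_of\<close> and
  \<open>perm_of_surj\<close>), length becoming the number of inner nodes.

  The simsun condition is compatible with this splitting. Consider \<open>L m R\<close>, where the maximum is
  \<open>m\<close> and \<open>R\<close> is nonempty. Its subwords of small entries are the subwords of \<open>R\<close>, the words \<open>F R\<close>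
  with \<open>F\<close> a nonempty subword of small entries of \<open>L\<close>, and the whole word. At the junction of \<open>F\<close>
  and \<open>R\<close> there is always a descent, so \<open>F R\<close> has no double descent iff neither part has one, \<open>F\<close>
  does not end with a descent and \<open>R\<close> does not start with one. So one needs two further
  conditions: not starting with a descent, and having no subword of small entries that ends with a
  descent. Both of them also decompose along the tree (\<open>simsun_tree_Node\<close>,
  \<open>no_final_descent_tree_Node\<close>, \<open>initial_descent_tree_Node\<close>).

  This gives a system of polynomial equations between the generating functions of the four classes
  of simsun trees determined by the two conditions. Eliminating three of them leaves the equation
  \<open>a = 1 + (z + z\<^sup>2) a + z\<^sup>3 a\<^sup>2\<close> (\<open>simsun_gf_equation\<close>). Completing the square turns it into
  \<open>(1 - z - z\<^sup>2 - 2 z\<^sup>3 a)\<^sup>2 = 1 - 2 z - z\<^sup>2 - 2 z\<^sup>3 + z\<^sup>4\<close>, and the constant term 1 selects the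
  square root that occurs in the generating function of the secondary structure numbers.
\<close>

section \<open>Permutations avoiding 132 as binary trees\<close>

text \<open>
  Avoidance of 132 by recursion over the word: a first entry \<open>x\<close> can only play the role of 1, and
  it does so exactly if the later entries above \<open>x\<close> contain an inversion. This form, unlike
  positions, is easy to evaluate on a concatenation.
\<close>
fun avoids_132 :: "nat list \<Rightarrow> bool" where
  "avoids_132 [] \<longleftrightarrow> True"
| "avoids_132 (x # xs) \<longleftrightarrow> sorted (filter (\<lambda>y. x < y) xs) \<and> avoids_132 xs"

lemma contains_132_iff:
  "contains_pattern w [1, 3, 2] \<longleftrightarrow>
     (\<exists>i j k. i < j \<and> j < k \<and> k < length w \<and> w ! i < w ! k \<and> w ! k < w ! j)"
  (is "?L \<longleftrightarrow> ?R")
proof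
  assume ?L
  then obtain f where mono: "strict_mono_on {..<3::nat} f"
    and len: "\<forall>a<3. f a < length w"
    and ord: "\<forall>a<3. \<forall>b<3. w ! f a < w ! f b \<longleftrightarrow> [1, 3, 2::nat] ! a < [1, 3, 2] ! b"
    by (auto simp: contains_pattern_def numeral_3_eq_3)
  have "f 0 < f 1" "f 1 < f 2"
    using mono by (auto simp: strict_mono_on_def)
  moreover have "w ! f 0 < w ! f 2" "w ! f 2 < w ! f 1"
    using ord by auto
  ultimately show ?R using len by (intro exI[of _ "f 0"] exI[of _ "f 1"] exI[of _ "f 2"]) auto
next
  assume ?R
  then obtain i j k where *: "i < j" "j < k" "k < length w" "w ! i < w ! k" "w ! k < w ! j"
    by blast
  define f where "f = (\<lambda>a::nat. [i, j, k] ! a)"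
  have lt: "a < length [1, 3, 2::nat] \<longleftrightarrow> a = 0 \<or> a = 1 \<or> a = 2" for a :: nat
    by auto
  show ?L
    unfolding contains_pattern_def
  proof (intro exI[of _ f] conjI)
    show "strict_mono_on {..<length [1, 3, 2::nat]} f"
      unfolding strict_mono_on_def lessThan_iff lt using * by (auto simp: f_def)
    show "\<forall>a<length [1, 3, 2::nat]. f a < length w"
      unfolding lt using * by (auto simp: f_def)
    show "\<forall>a<length [1, 3, 2::nat]. \<forall>b<length [1, 3, 2::nat].
            (w ! f a < w ! f b) = ([1, 3, 2::nat] ! a < [1, 3, 2] ! b)"
      unfolding lt using * by (auto simp: f_def)
  qed
qed

lemma sorted_filter_greater_iff:
  "sorted (filter (\<lambda>y. (x::nat) < y) xs) \<longleftrightarrow>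
     \<not> (\<exists>j k. j < k \<and> k < length xs \<and> x < xs ! k \<and> xs ! k < xs ! j)"
proof (induction xs)
  case Nil
  then show ?case by simp
next
  case (Cons a xs)
  have "(\<exists>j k. j < k \<and> k < length (a # xs) \<and> x < (a # xs) ! k \<and> (a # xs) ! k < (a # xs) ! j) \<longleftrightarrow>
     (\<exists>k<length xs. x < xs ! k \<and> xs ! k < a) \<or>
     (\<exists>j k. j < k \<and> k < length xs \<and> x < xs ! k \<and> xs ! k < xs ! j)" (is "?L = ?R")
  proof
    assume ?L
    then obtain j k where "j < k" "k < length (a # xs)" "x < (a # xs) ! k"
        "(a # xs) ! k < (a # xs) ! j"
      by blast
    then show ?R by (cases j; cases k) auto
  next
    assume ?R
    then show ?L
    proof (elim disjE exE conjE)
      fix k assume "k < length xs" "x < xs ! k" "xs ! k < a"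
      then show ?L by (intro exI[of _ 0] exI[of _ "Suc k"]) auto
    next
      fix j k assume "j < k" "k < length xs" "x < xs ! k" "xs ! k < xs ! j"
      then show ?L by (intro exI[of _ "Suc j"] exI[of _ "Suc k"]) auto
    qed
  qed
  moreover have "(\<exists>k<length xs. x < xs ! k \<and> xs ! k < a) \<longleftrightarrow> (\<exists>y\<in>set xs. x < y \<and> y < a)"
    unfolding set_conv_nth by auto
  ultimately show ?case
    using Cons by (auto simp: not_less)
qed

lemma avoids_132_iff: "avoids_132 w \<longleftrightarrow> \<not> contains_pattern w [1, 3, 2]"
proof (induction w)
  case Nil
  show ?case unfolding contains_132_iff by simp
next
  case (Cons x w)
  have "contains_pattern (x # w) [1, 3, 2] \<longleftrightarrow> contains_pattern w [1, 3, 2] \<or>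
      (\<exists>j k. j < k \<and> k < length w \<and> x < w ! k \<and> w ! k < w ! j)" (is "?L = ?R")
  proof
    assume ?L
    then obtain i j k where "i < j" "j < k" "k < length (x # w)" "(x # w) ! i < (x # w) ! k"
        "(x # w) ! k < (x # w) ! j"
      unfolding contains_132_iff by blast
    then show ?R
      unfolding contains_132_iff by (cases i; cases j; cases k) auto
  next
    assume ?R
    then show ?L
      unfolding contains_132_iff
    proof (elim disjE exE conjE)
      fix i j k
      assume "i < j" "j < k" "k < length w" "w ! i < w ! k" "w ! k < w ! j"
      then show "\<exists>i j k. i < j \<and> j < k \<and> k < length (x # w) \<and> (x # w) ! i < (x # w) ! k \<and>
           (x # w) ! k < (x # w) ! j"
        by (intro exI[of _ "Suc i"] exI[of _ "Suc j"] exI[of _ "Suc k"]) auto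
    next
      fix j k
      assume "j < k" "k < length w" "x < w ! k" "w ! k < w ! j"
      then show "\<exists>i j k. i < j \<and> j < k \<and> k < length (x # w) \<and> (x # w) ! i < (x # w) ! k \<and>
           (x # w) ! k < (x # w) ! j"
        by (intro exI[of _ 0] exI[of _ "Suc j"] exI[of _ "Suc k"]) auto
    qed
  qed
  then show ?case
    using Cons unfolding avoids_132.simps sorted_filter_greater_iff by blast
qed

text \<open>
  An entry \<open>x\<close> on the left, the maximum \<open>m\<close> and an entry \<open>y > x\<close> on the right would form 132. If
  there is no such pair, no occurrence can use \<open>m\<close> or entries from both sides.
\<close>
lemma avoids_132_append_max:
  assumes "\<And>x. x \<in> set L \<Longrightarrow> x < m" "\<And>y. y \<in> set R \<Longrightarrow> y < m"
  shows "avoids_132 (L @ m # R) \<longleftrightarrow>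
     avoids_132 L \<and> avoids_132 R \<and> (\<forall>x\<in>set L. \<forall>y\<in>set R. y \<le> x)"
  using assms(1)
proof (induction L)
  case Nil
  have "filter (\<lambda>y. m < y) R = []"
    using assms(2) by (auto simp: filter_empty_conv dest: less_asym)
  then show ?case by simp
next
  case (Cons x L)
  have "sorted (filter ((<) x) (L @ m # R)) \<longleftrightarrow>
      sorted (filter ((<) x) L) \<and> (\<forall>y\<in>set R. y \<le> x)" (is "?l = ?r")
  proof
    assume l: ?l
    have "y \<le> x" if "y \<in> set R" for y
      using l Cons.prems that assms(2)[OF that] by (fastforce simp: sorted_append)
    with l show ?r by (auto simp: sorted_append)
  next
    assume r: ?r
    then have "filter ((<) x) R = []"
      by (auto simp: filter_empty_conv not_less)
    with r Cons.prems show ?l by (auto simp: sorted_append less_imp_le)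
  qed
  with Cons show ?case by auto
qed

lemma avoids_132_shift [simp]: "avoids_132 (map (\<lambda>x. x + k) w) \<longleftrightarrow> avoids_132 w"
  by (induction w) (simp_all add: filter_map o_def sorted_map)

datatype bintree = Leaf | Node bintree bintree

fun perm_of :: "bintree \<Rightarrow> nat list" where
  "perm_of Leaf = []"
| "perm_of (Node l r) =
     map (\<lambda>x. x + size r) (perm_of l) @ Suc (size l + size r) # perm_of r"

lemma length_perm_of [simp]: "length (perm_of t) = size t"
  by (induction t) auto

lemma perm_of_eq_Nil_iff [simp]: "perm_of t = [] \<longleftrightarrow> t = Leaf"
  by (cases t) auto

lemma set_perm_of: "set (perm_of t) = {1..size t}"
proof (induction t)
  case (Node l r)
  have "(\<lambda>x. x + size r) ` {1..size l} = {size r + 1..size l + size r}"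
    by (simp add: image_add_atLeastAtMost' add.commute)
  with Node show ?case by auto
qed auto

lemma distinct_perm_of: "distinct (perm_of t)"
  by (induction t) (auto simp: distinct_map set_perm_of)

lemma perm_of_in_permutations: "perm_of t \<in> permutations_of_set {1..size t}"
  by (simp add: permutations_of_set_def set_perm_of distinct_perm_of)

lemma avoids_132_perm_of: "avoids_132 (perm_of t)"
proof (induction t)
  case (Node l r)
  then show ?case
    by (simp, subst avoids_132_append_max) (auto simp: set_perm_of)
qed auto

lemma inj_perm_of: "inj perm_of"
proof
  fix t u show "perm_of t = perm_of u \<Longrightarrow> t = u"
  proof (induction t arbitrary: u)
    case Leaf
    then show ?case by (cases u) auto
  next
    case (Node l r)
    obtain l' r' where u: "u = Node l' r'"
      using Node.prems by (cases u) auto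
    let ?m = "Suc (size l + size r)"
    have sz: "size l + size r = size l' + size r'"
      using arg_cong[OF Node.prems, of length] by (simp add: u)
    have "?m \<notin> set (map (\<lambda>x. x + size r) (perm_of l))" "?m \<notin> set (perm_of r)"
      by (auto simp: set_perm_of)
    then have *: "map (\<lambda>x. x + size r) (perm_of l) = map (\<lambda>x. x + size r') (perm_of l')"
        "perm_of r = perm_of r'"
      using Node.prems by (simp_all add: u sz append_Cons_eq_iff)
    have r: "r = r'" using *(2) by (rule Node.IH(2))
    have "inj (\<lambda>x. x + size r')" by (auto simp: inj_def)
    with *(1) have "perm_of l = perm_of l'" by (simp add: r inj_map_eq_map)
    then have "l = l'" by (rule Node.IH(1))
    with r u show ?case by simp
  qed
qed

text \<open>
  For the two sides of the maximum, this determines the sets of entries from the length of the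
  right side alone, so that a tree needs no labels.
\<close>
lemma upper_part_is_shifted_interval:
  assumes un: "A \<union> B = {1..n}" and ord: "\<And>x y. x \<in> A \<Longrightarrow> y \<in> B \<Longrightarrow> y < (x::nat)"
  shows "B = {1..card B}" "A = {card B + 1..n}"
proof -
  have fin: "finite B" using un by (metis finite_Un finite_atLeastAtMost)
  have sub: "B \<subseteq> {1..n}" using un by blast
  show "B = {1..card B}"
  proof (cases "B = {}")
    case False
    have "B = {1..Max B}"
    proof
      show "B \<subseteq> {1..Max B}" using sub fin by auto
      show "{1..Max B} \<subseteq> B"
      proof
        fix x assume x: "x \<in> {1..Max B}"
        have "Max B \<in> B" using fin False by simp
        then have "x \<in> A \<union> B" using x sub un by auto
        then show "x \<in> B" using ord[of x "Max B"] x \<open>Max B \<in> B\<close> by auto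
      qed
    qed
    then show ?thesis by (metis card_atLeastAtMost diff_Suc_1 Suc_eq_plus1)
  qed auto
  moreover have "A = {1..n} - B" using un ord by auto
  moreover have "{1..n} - {1..card B} = {card B + 1..n}" by auto
  ultimately show "A = {card B + 1..n}" by argo
qed

lemma perm_of_surj:
  assumes "distinct w" "set w = {1..n}" "avoids_132 w"
  shows "\<exists>t. perm_of t = w"
  using assms
proof (induction n arbitrary: w rule: less_induct)
  case (less n)
  show ?case
  proof (cases n)
    case 0
    then have "perm_of Leaf = w" using less.prems by simp
    then show ?thesis by blast
  next
    case (Suc m)
    then have "n \<in> set w" using less.prems by simp
    then obtain L R where w: "w = L @ n # R" by (auto simp: in_set_conv_decomp)
    have un: "set L \<union> set R = {1..m}"
    proof -
      have "set L \<union> set R = {1..n} - {n}" using less.prems(1,2) w by auto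
      moreover have "{1..Suc m} - {Suc m} = {1..m}" by auto
      ultimately show ?thesis by (simp only: Suc)
    qed
    then have lt: "x \<in> set L \<Longrightarrow> x < n" "x \<in> set R \<Longrightarrow> x < n" for x
      using Suc by (metis UnCI atLeastAtMost_iff less_Suc_eq_le)+
    have av: "avoids_132 L" "avoids_132 R" "\<forall>x\<in>set L. \<forall>y\<in>set R. y \<le> x"
      using less.prems(3) avoids_132_append_max[of L n R] lt unfolding w by auto
    have ord: "y < x" if "x \<in> set L" "y \<in> set R" for x y
      using av(3) that less.prems(1) w by (auto simp: order.strict_iff_order)
    define k where "k = length R"
    have dist: "distinct L" "distinct R" using less.prems(1) w by auto
    then have card: "card (set R) = k" by (simp add: k_def distinct_card)
    have setR: "set R = {1..k}" and setL: "set L = {k + 1..m}"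
      using upper_part_is_shifted_interval[OF un ord] by (simp_all add: card)
    have len: "length w = n"
      using distinct_card[OF less.prems(1)] less.prems(2) by simp
    have km: "k \<le> m" and lenL: "length L = m - k"
      using len w Suc by (simp_all add: k_def)
    obtain r where r: "perm_of r = R"
      using less.IH[of k R] dist setR av km Suc by auto
    define L0 where "L0 = map (\<lambda>x. x - k) L"
    have L: "L = map (\<lambda>x. x + k) L0"
      unfolding L0_def map_map o_def by (rule map_idI[symmetric]) (auto simp: setL)
    have "set L0 = {1..m - k}"
    proof -
      have "(\<lambda>x. x + k) ` set L0 = (\<lambda>x. x + k) ` {1..m - k}"
        using setL km unfolding L set_map by (simp add: image_add_atLeastAtMost' add.commute)
      then show ?thesis by (subst (asm) inj_image_eq_iff) (auto simp: inj_def)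
    qed
    moreover have "distinct L0" "avoids_132 L0"
      using dist(1) av(1) unfolding L by (auto simp: distinct_map)
    ultimately obtain l where l: "perm_of l = L0"
      using less.IH[of "m - k" L0] Suc diff_less_Suc[of m k] by blast
    have "size r = k" "size l = m - k"
      using r l lenL unfolding k_def L0_def by (metis length_perm_of length_map)+
    then have "perm_of (Node l r) = w" using l r w L km Suc by simp
    then show ?thesis by blast
  qed
qed

lemma finite_size_eq: "finite {t :: bintree. size t = n}"
proof (rule finite_imageD)
  show "finite (perm_of ` {t. size t = n})"
    by (rule finite_subset[of _ "permutations_of_set {1..n}"])
      (use perm_of_in_permutations in auto)
  show "inj_on perm_of {t. size t = n}"
    using inj_perm_of by (rule inj_on_subset) simp
qed

section \<open>The simsun condition on trees\<close>

fun starts_with_descent :: "nat list \<Rightarrow> bool" where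
  "starts_with_descent (x # y # w) \<longleftrightarrow> y < x"
| "starts_with_descent _ \<longleftrightarrow> False"

fun ends_with_descent :: "nat list \<Rightarrow> bool" where
  "ends_with_descent [x, y] \<longleftrightarrow> y < x"
| "ends_with_descent (x # y # z # w) \<longleftrightarrow> ends_with_descent (y # z # w)"
| "ends_with_descent _ \<longleftrightarrow> False"

lemma has_double_descent_short: "length w < 3 \<Longrightarrow> \<not> has_double_descent w"
  by (auto simp: has_double_descent_def)

lemma has_double_descent_Nil [simp]: "\<not> has_double_descent []"
  by (simp add: has_double_descent_short)

lemma has_double_descent_Cons:
  "has_double_descent (x # w) \<longleftrightarrow>
     has_double_descent w \<or> w \<noteq> [] \<and> hd w < x \<and> starts_with_descent w"
proof
  assume "has_double_descent (x # w)"
  then obtain i where i: "i + 2 < length (x # w)" "(x # w) ! (i + 1) < (x # w) ! i"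
      "(x # w) ! (i + 2) < (x # w) ! (i + 1)"
    by (auto simp: has_double_descent_def)
  show "has_double_descent w \<or> w \<noteq> [] \<and> hd w < x \<and> starts_with_descent w"
  proof (cases i)
    case 0
    with i obtain y z v where "w = y # z # v"
      by (cases w rule: starts_with_descent.cases) auto
    with i 0 show ?thesis by (auto simp: numeral_2_eq_2)
  next
    case (Suc j)
    with i have "has_double_descent w"
      unfolding has_double_descent_def by (intro exI[of _ j]) auto
    then show ?thesis ..
  qed
next
  assume "has_double_descent w \<or> w \<noteq> [] \<and> hd w < x \<and> starts_with_descent w"
  then show "has_double_descent (x # w)"
  proof
    assume "has_double_descent w"
    then obtain i where "i + 2 < length w" "w ! (i + 1) < w ! i" "w ! (i + 2) < w ! (i + 1)"
      by (auto simp: has_double_descent_def)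
    then show ?thesis unfolding has_double_descent_def by (intro exI[of _ "Suc i"]) auto
  next
    assume *: "w \<noteq> [] \<and> hd w < x \<and> starts_with_descent w"
    then obtain y z v where "w = y # z # v"
      by (cases w rule: starts_with_descent.cases) auto
    with * show ?thesis
      unfolding has_double_descent_def by (intro exI[of _ 0]) (auto simp: numeral_2_eq_2)
  qed
qed

text \<open>
  The junction of \<open>X\<close> and \<open>Y\<close> is a descent, so a double descent lies within \<open>X\<close>, within \<open>Y\<close>, or
  prolongs the descent at the junction to the left or to the right.
\<close>
lemma has_double_descent_append:
  assumes "X \<noteq> []" "Y \<noteq> []" "\<And>x y. x \<in> set X \<Longrightarrow> y \<in> set Y \<Longrightarrow> y < x"
  shows "has_double_descent (X @ Y) \<longleftrightarrow>
     has_double_descent X \<or> has_double_descent Y \<or> ends_with_descent X \<or> starts_with_descent Y"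
  using assms(1,3)
proof (induction X)
  case (Cons x X)
  obtain y Y' where Y: "Y = y # Y'" using assms(2) by (cases Y) auto
  show ?case
  proof (cases X)
    case Nil
    with Cons.prems Y show ?thesis by (auto simp: has_double_descent_Cons)
  next
    case (Cons x' X')
    have "y < x'" using Cons.prems Y Cons by simp
    then show ?thesis
      using Cons.IH Cons.prems Cons Y
      by (cases X') (auto simp: has_double_descent_Cons)
  qed
qed auto

lemma has_double_descent_snoc_max:
  assumes "\<And>x. x \<in> set L \<Longrightarrow> x < m"
  shows "has_double_descent (L @ [m]) \<longleftrightarrow> has_double_descent L"
  using assms
proof (induction L)
  case (Cons x L)
  have "\<forall>y\<in>set (x # L). \<not> m < y" using Cons.prems by (simp add: not_less less_imp_le)
  moreover have "has_double_descent (L @ [m]) \<longleftrightarrow> has_double_descent L"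
    using Cons by simp
  ultimately show ?case
    by (cases L rule: starts_with_descent.cases) (simp_all add: has_double_descent_Cons)
qed (auto simp: has_double_descent_Cons)

lemma ends_with_descent_append:
  "2 \<le> length Y \<Longrightarrow> ends_with_descent (X @ Y) \<longleftrightarrow> ends_with_descent Y"
proof (induction X)
  case (Cons x X)
  then obtain a b v where "X @ Y = a # b # v"
    by (cases "X @ Y" rule: starts_with_descent.cases) (auto dest: arg_cong[of _ _ length])
  with Cons show ?case by simp
qed simp

lemma ends_with_descent_snoc:
  "X \<noteq> [] \<Longrightarrow> ends_with_descent (X @ [y]) \<longleftrightarrow> y < last X"
  by (induction X rule: ends_with_descent.induct) auto

lemma has_double_descent_append_max:
  assumes L: "\<And>x. x \<in> set L \<Longrightarrow> x < m" and R: "R \<noteq> []" "\<And>y. y \<in> set R \<Longrightarrow> y < m"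
    and LR: "\<And>x y. x \<in> set L \<Longrightarrow> y \<in> set R \<Longrightarrow> y < x"
  shows "has_double_descent (L @ m # R) \<longleftrightarrow>
     has_double_descent L \<or> has_double_descent R \<or> starts_with_descent R"
proof -
  have "\<not> ends_with_descent (L @ [m])"
    using L by (cases "L = []") (auto simp: ends_with_descent_snoc dest: less_asym)
  then show ?thesis
    using has_double_descent_append[of "L @ [m]" R] assms has_double_descent_snoc_max[of L m]
    by auto
qed

text \<open>
  The simsun condition is of this form, and so is the condition at the end of the left part that
  it entails. The bound ranges over all numbers, which avoids side conditions in the lemmas below.
\<close>
definition hereditarily :: "(nat list \<Rightarrow> bool) \<Rightarrow> nat list \<Rightarrow> bool" where
  "hereditarily P w \<longleftrightarrow> (\<forall>k. P (filter (\<lambda>x. x \<le> k) w))"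

lemma hereditarily_self: "hereditarily P w \<Longrightarrow> P w"
proof -
  assume "hereditarily P w"
  then have "P (filter (\<lambda>x. x \<le> Max (set w)) w)" unfolding hereditarily_def by blast
  moreover have "filter (\<lambda>x. x \<le> Max (set w)) w = w"
    by (auto simp: filter_id_conv)
  ultimately show "P w" by argo
qed

lemma hereditarily_Nil [simp]: "hereditarily P [] \<longleftrightarrow> P []"
  by (simp add: hereditarily_def)

lemma hereditarily_shift:
  assumes "\<And>w. P (map (\<lambda>x. x + k) w) \<longleftrightarrow> P w" and "P []"
  shows "hereditarily P (map (\<lambda>x. x + k) w) \<longleftrightarrow> hereditarily P w"
proof
  assume h: "hereditarily P (map (\<lambda>x. x + k) w)"
  show "hereditarily P w"
    unfolding hereditarily_def
  proof
    fix j
    have "P (filter (\<lambda>x. x \<le> j + k) (map (\<lambda>x. x + k) w))"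
      using h unfolding hereditarily_def by blast
    then show "P (filter (\<lambda>x. x \<le> j) w)" by (simp add: filter_map o_def assms(1))
  qed
next
  assume h: "hereditarily P w"
  show "hereditarily P (map (\<lambda>x. x + k) w)"
    unfolding hereditarily_def
  proof
    fix j
    show "P (filter (\<lambda>x. x \<le> j) (map (\<lambda>x. x + k) w))"
    proof (cases "k \<le> j")
      case True
      then have "(\<lambda>x. x + k \<le> j) = (\<lambda>x. x \<le> j - k)" by auto
      then show ?thesis using h by (simp add: filter_map o_def assms(1) hereditarily_def)
    next
      case False
      then have "filter (\<lambda>x. x \<le> j) (map (\<lambda>x. x + k) w) = []"
        by (auto simp: filter_empty_conv)
      then show ?thesis using assms(2) by simp
    qed
  qed
qed

text \<open>
  The three conjuncts correspond to bounds that are at least \<open>m\<close>, that cut below all of \<open>L\<close>, and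
  that lie in between and keep some part of \<open>L\<close>; in the last case all of \<open>R\<close> survives, and the
  maximum does not.
\<close>
lemma hereditarily_append_max:
  assumes R: "\<And>y. y \<in> set R \<Longrightarrow> y \<le> j" and L: "\<And>x. x \<in> set L \<Longrightarrow> j < x \<and> x < m" and m: "j < m"
  shows "hereditarily P (L @ m # R) \<longleftrightarrow>
     P (L @ m # R) \<and> hereditarily P R \<and>
     (\<forall>k. filter (\<lambda>x. x \<le> k) L \<noteq> [] \<longrightarrow> P (filter (\<lambda>x. x \<le> k) L @ R))" (is "?l = ?r")
proof
  assume l: ?l
  show ?r
  proof (intro conjI allI impI)
    show "P (L @ m # R)" using l by (rule hereditarily_self)
    show "hereditarily P R"
      unfolding hereditarily_def
    proof
      fix k
      have "filter (\<lambda>x. x \<le> min j k) L = []"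
        by (auto simp: filter_empty_conv dest!: L)
      moreover have "filter (\<lambda>x. x \<le> min j k) R = filter (\<lambda>x. x \<le> k) R"
        by (intro filter_cong refl) (auto dest!: R)
      ultimately have "filter (\<lambda>x. x \<le> min j k) (L @ m # R) = filter (\<lambda>x. x \<le> k) R"
        using m by auto
      then show "P (filter (\<lambda>x. x \<le> k) R)" using l unfolding hereditarily_def by metis
    qed
    fix k assume ne: "filter (\<lambda>x. x \<le> k) L \<noteq> []"
    then obtain x where "x \<in> set L" "x \<le> k" by (auto simp: filter_empty_conv)
    then have "j < k" using L[of x] by simp
    have "filter (\<lambda>x. x \<le> min k (m - 1)) L = filter (\<lambda>x. x \<le> k) L"
      by (intro filter_cong refl) (auto dest!: L)
    moreover have "filter (\<lambda>x. x \<le> min k (m - 1)) R = R"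
      using m \<open>j < k\<close> by (auto simp: filter_id_conv dest!: R)
    ultimately have "filter (\<lambda>x. x \<le> min k (m - 1)) (L @ m # R) = filter (\<lambda>x. x \<le> k) L @ R"
      using m by auto
    then show "P (filter (\<lambda>x. x \<le> k) L @ R)" using l unfolding hereditarily_def by metis
  qed
next
  assume r: ?r
  show ?l
    unfolding hereditarily_def
  proof
    fix k
    consider "m \<le> k" | "k < m" "filter (\<lambda>x. x \<le> k) L = []" | "k < m" "filter (\<lambda>x. x \<le> k) L \<noteq> []"
      by linarith
    then show "P (filter (\<lambda>x. x \<le> k) (L @ m # R))"
    proof cases
      case 1
      have "filter (\<lambda>x. x \<le> k) L = L" "filter (\<lambda>x. x \<le> k) R = R"
        using 1 m by (auto simp: filter_id_conv dest!: L R)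
      then have "filter (\<lambda>x. x \<le> k) (L @ m # R) = L @ m # R"
        using 1 by simp
      with r show ?thesis by simp
    next
      case 2
      with r show ?thesis by (simp add: hereditarily_def)
    next
      case 3
      then obtain x where "x \<in> set L" "x \<le> k" by (auto simp: filter_empty_conv)
      then have "j < k" using L[of x] by simp
      then have "filter (\<lambda>x. x \<le> k) R = R" by (auto simp: filter_id_conv dest!: R)
      with 3 r show ?thesis by simp
    qed
  qed
qed

text \<open>
  Bounds outside the range from 3 to the length add nothing: below 3 the subword is too short for
  a double descent, and above the length it is the whole word.
\<close>
lemma simsun_iff_hereditarily:
  assumes "w \<in> permutations_of_set {1..n}"
  shows "simsun w \<longleftrightarrow> hereditarily (\<lambda>v. \<not> has_double_descent v) w"
proof -
  have w: "set w = {1..n}" "distinct w" using assms by (auto simp: permutations_of_set_def)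
  have len: "length w = n" using distinct_card[OF w(2)] w(1) by simp
  have eq: "filter (\<lambda>x. x \<in> {1..k}) w = filter (\<lambda>x. x \<le> k) w" for k
    using w(1) by (intro filter_cong) auto
  have small: "length (filter (\<lambda>x. x \<le> k) w) \<le> k" for k
  proof -
    have "length (filter (\<lambda>x. x \<le> k) w) = card (set (filter (\<lambda>x. x \<le> k) w))"
      by (rule distinct_card[symmetric]) (simp add: w(2))
    also have "\<dots> \<le> card {1..k}" using w(1) by (intro card_mono) auto
    finally show ?thesis by simp
  qed
  have "\<not> has_double_descent (filter (\<lambda>x. x \<le> k) w)" if s: "simsun w" for k
  proof -
    consider "k < 3" | "3 \<le> k" "k \<le> n" | "n < k" "3 \<le> n" | "n < 3" by linarith
    then show ?thesis
    proof cases
      case 1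
      then show ?thesis using small[of k] by (intro has_double_descent_short) simp
    next
      case 2
      then show ?thesis using s unfolding simsun_def len eq by blast
    next
      case 3
      then have "filter (\<lambda>x. x \<le> k) w = filter (\<lambda>x. x \<le> n) w"
        using w(1) by (intro filter_cong) auto
      then show ?thesis using 3 s unfolding simsun_def len eq by simp
    next
      case 4
      have "length (filter (\<lambda>x. x \<le> k) w) \<le> length w" by simp
      then show ?thesis using 4 len by (intro has_double_descent_short) simp
    qed
  qed
  then show ?thesis
    unfolding simsun_def hereditarily_def eq by blast
qed

definition simsun_tree :: "bintree \<Rightarrow> bool" where
  "simsun_tree t \<longleftrightarrow> hereditarily (\<lambda>w. \<not> has_double_descent w) (perm_of t)"

definition no_final_descent_tree :: "bintree \<Rightarrow> bool" where
  "no_final_descent_tree t \<longleftrightarrow> hereditarily (\<lambda>w. \<not> ends_with_descent w) (perm_of t)"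

definition initial_descent_tree :: "bintree \<Rightarrow> bool" where
  "initial_descent_tree t \<longleftrightarrow> starts_with_descent (perm_of t)"

lemma starts_with_descent_shift [simp]:
  "starts_with_descent (map (\<lambda>x. x + k) w) \<longleftrightarrow> starts_with_descent w"
  by (induction w rule: starts_with_descent.induct) auto

lemma ends_with_descent_shift [simp]:
  "ends_with_descent (map (\<lambda>x. x + k) w) \<longleftrightarrow> ends_with_descent w"
  by (induction w rule: ends_with_descent.induct) auto

lemma has_double_descent_shift [simp]:
  "has_double_descent (map (\<lambda>x. x + k) w) \<longleftrightarrow> has_double_descent w"
  by (induction w) (auto simp: has_double_descent_Cons hd_map)

lemma tree_predicates_Leaf [simp]:
  "simsun_tree Leaf" "no_final_descent_tree Leaf" "\<not> initial_descent_tree Leaf"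
  by (auto simp: simsun_tree_def no_final_descent_tree_def initial_descent_tree_def)

text \<open>
  If the left part is empty, the word starts with its maximum; if it is a single entry, the word
  starts with an ascent to the maximum, in accordance with the value for a single node.
\<close>
lemma initial_descent_tree_Node [simp]:
  "initial_descent_tree (Node l r) \<longleftrightarrow>
     (if l = Leaf then r \<noteq> Leaf else initial_descent_tree l)"
proof (cases "l = Leaf")
  case True
  show ?thesis
  proof (cases "perm_of r")
    case (Cons y ys)
    have "y \<in> set (perm_of r)" using Cons by simp
    then have "y \<le> size r" by (simp add: set_perm_of)
    moreover have "r \<noteq> Leaf" using Cons by auto
    ultimately show ?thesis using True Cons by (simp add: initial_descent_tree_def)
  qed (use True in \<open>auto simp: initial_descent_tree_def\<close>)
next
  case False
  then have "perm_of l \<noteq> []" by simp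
  then obtain x xs where l: "perm_of l = x # xs" by (cases "perm_of l") auto
  have "x \<in> set (perm_of l)" using l by simp
  then have "x \<le> size l" by (simp add: set_perm_of)
  then show ?thesis
    using False l by (cases xs) (auto simp: initial_descent_tree_def)
qed

text \<open>
  For nonempty \<open>R\<close>, each nonempty subword of small entries of \<open>L\<close> stands directly before \<open>R\<close> once
  the maximum is removed, so it must not end with a descent. In the whole word the maximum stands
  directly before \<open>R\<close>, so \<open>R\<close> must not start with a descent, even if \<open>L\<close> is empty.
\<close>
lemma simsun_tree_Node [simp]:
  "simsun_tree (Node l r) \<longleftrightarrow> simsun_tree l \<and>
     (r = Leaf \<or> no_final_descent_tree l \<and> simsun_tree r \<and> \<not> initial_descent_tree r)"
proof -
  let ?P = "\<lambda>w. \<not> has_double_descent w"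
  define L where "L = map (\<lambda>x. x + size r) (perm_of l)"
  define m where "m = Suc (size l + size r)"
  define R where "R = perm_of r"
  have R: "y \<le> size r" if "y \<in> set R" for y using that by (simp add: R_def set_perm_of)
  have L: "size r < x \<and> x < m" if "x \<in> set L" for x
    using that by (auto simp: L_def set_perm_of m_def)
  have m: "size r < m" by (simp add: m_def)
  have LR: "y < x" if "x \<in> set L" "y \<in> set R" for x y using L R that by fastforce
  have node: "simsun_tree (Node l r) \<longleftrightarrow> ?P (L @ m # R) \<and> hereditarily ?P R \<and>
     (\<forall>k. filter (\<lambda>x. x \<le> k) L \<noteq> [] \<longrightarrow> ?P (filter (\<lambda>x. x \<le> k) L @ R))"
    unfolding simsun_tree_def perm_of.simps L_def[symmetric] m_def[symmetric] R_def[symmetric]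
    by (rule hereditarily_append_max[OF R L m])
  have sl: "simsun_tree l \<longleftrightarrow> hereditarily ?P L"
    unfolding simsun_tree_def L_def by (rule hereditarily_shift[symmetric]) simp_all
  have el: "no_final_descent_tree l \<longleftrightarrow> hereditarily (\<lambda>w. \<not> ends_with_descent w) L"
    unfolding no_final_descent_tree_def L_def by (rule hereditarily_shift[symmetric]) simp_all
  show ?thesis
  proof (cases "r = Leaf")
    case True
    then have "R = []" by (simp add: R_def)
    moreover have "?P (L @ [m]) \<longleftrightarrow> ?P L"
      using has_double_descent_snoc_max[of L m] L by auto
    moreover have "hereditarily ?P L \<longleftrightarrow> ?P L \<and>
       (\<forall>k. filter (\<lambda>x. x \<le> k) L \<noteq> [] \<longrightarrow> ?P (filter (\<lambda>x. x \<le> k) L))"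
      using hereditarily_self[of ?P L] unfolding hereditarily_def
      by (metis has_double_descent_Nil)
    ultimately show ?thesis using True node sl by simp
  next
    case False
    then have ne: "R \<noteq> []" by (simp add: R_def)
    have full: "?P (L @ m # R) \<longleftrightarrow> ?P L \<and> ?P R \<and> \<not> starts_with_descent R"
      using has_double_descent_append_max[of L m R] L R m ne LR by fastforce
    have part: "?P (filter (\<lambda>x. x \<le> k) L @ R) \<longleftrightarrow> ?P (filter (\<lambda>x. x \<le> k) L) \<and> ?P R \<and>
        \<not> ends_with_descent (filter (\<lambda>x. x \<le> k) L) \<and> \<not> starts_with_descent R"
      if "filter (\<lambda>x. x \<le> k) L \<noteq> []" for k
      using has_double_descent_append[OF that ne] LR by auto
    have "simsun_tree (Node l r) \<longleftrightarrow> hereditarily ?P L \<and>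
        hereditarily (\<lambda>w. \<not> ends_with_descent w) L \<and> hereditarily ?P R \<and> \<not> starts_with_descent R"
      (is "_ = ?rhs")
    proof
      assume a: "simsun_tree (Node l r)"
      have "?P (filter (\<lambda>x. x \<le> k) L) \<and> \<not> ends_with_descent (filter (\<lambda>x. x \<le> k) L)" for k
        using a[unfolded node] part[of k] by (cases "filter (\<lambda>x. x \<le> k) L = []") auto
      then show ?rhs using a[unfolded node] full by (simp add: hereditarily_def)
    next
      assume b: ?rhs
      then have "?P L" "?P R" using hereditarily_self[of ?P] by blast+
      with b show "simsun_tree (Node l r)"
        unfolding node full by (auto simp: part) (auto simp: hereditarily_def)
    qed
    then show ?thesis
      using False sl el by (auto simp: simsun_tree_def R_def initial_descent_tree_def)
  qed
qed

text \<open>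
  A right part with at least two entries hides everything before it; a right part with one entry
  is itself the bottom of a descent from the maximum.
\<close>
lemma no_final_descent_tree_Node [simp]:
  "no_final_descent_tree (Node l r) \<longleftrightarrow>
     (if r = Leaf then no_final_descent_tree l else r \<noteq> Node Leaf Leaf \<and> no_final_descent_tree r)"
proof -
  let ?P = "\<lambda>w. \<not> ends_with_descent w"
  define L where "L = map (\<lambda>x. x + size r) (perm_of l)"
  define m where "m = Suc (size l + size r)"
  define R where "R = perm_of r"
  have R: "y \<le> size r" if "y \<in> set R" for y using that by (simp add: R_def set_perm_of)
  have L: "size r < x \<and> x < m" if "x \<in> set L" for x
    using that by (auto simp: L_def set_perm_of m_def)
  have m: "size r < m" by (simp add: m_def)
  have node: "no_final_descent_tree (Node l r) \<longleftrightarrow> ?P (L @ m # R) \<and> hereditarily ?P R \<and>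
     (\<forall>k. filter (\<lambda>x. x \<le> k) L \<noteq> [] \<longrightarrow> ?P (filter (\<lambda>x. x \<le> k) L @ R))"
    unfolding no_final_descent_tree_def perm_of.simps L_def[symmetric] m_def[symmetric]
      R_def[symmetric]
    by (rule hereditarily_append_max[OF R L m])
  have el: "no_final_descent_tree l \<longleftrightarrow> hereditarily ?P L"
    unfolding no_final_descent_tree_def L_def by (rule hereditarily_shift[symmetric]) simp_all
  consider "r = Leaf" | "r = Node Leaf Leaf" | "2 \<le> size r"
  proof (cases r)
    case (Node a b)
    then show ?thesis using that by (cases a; cases b) auto
  qed (use that in auto)
  then show ?thesis
  proof cases
    case 1
    then have "R = []" by (simp add: R_def)
    moreover have "?P (L @ [m])"
      using L by (cases "L = []") (auto simp: ends_with_descent_snoc dest: less_asym)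
    moreover have "hereditarily ?P L \<longleftrightarrow>
       (\<forall>k. filter (\<lambda>x. x \<le> k) L \<noteq> [] \<longrightarrow> ?P (filter (\<lambda>x. x \<le> k) L))"
      unfolding hereditarily_def by (metis ends_with_descent.simps(3))
    ultimately show ?thesis using 1 node el by simp
  next
    case 2
    then have "R = [1]" by (simp add: R_def)
    moreover have "\<not> ?P (L @ [m, 1])"
      using ends_with_descent_append[of "[m, 1]" L] m 2 by simp
    ultimately show ?thesis using 2 node by simp
  next
    case 3
    then have len: "2 \<le> length R" by (simp add: R_def)
    have "?P (X @ R) \<longleftrightarrow> ?P R" for X using ends_with_descent_append[OF len] by simp
    moreover have "?P (L @ m # R) \<longleftrightarrow> ?P R"
      using ends_with_descent_append[OF len, of "L @ [m]"] by simp
    ultimately have "no_final_descent_tree (Node l r) \<longleftrightarrow> hereditarily ?P R"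
      using node hereditarily_self[of ?P R] by auto
    then show ?thesis using 3 by (auto simp: R_def no_final_descent_tree_def)
  qed
qed

lemma card_RS_132: "card (RS n [1, 3, 2]) = card {t \<in> Collect simsun_tree. size t = n}"
proof -
  have "RS n [1, 3, 2] = perm_of ` {t \<in> Collect simsun_tree. size t = n}"
  proof (intro equalityI subsetI)
    fix w assume "w \<in> RS n [1, 3, 2]"
    then have w: "w \<in> permutations_of_set {1..n}" "simsun w" "avoids_132 w"
      by (auto simp: RS_def avoids_132_iff)
    then obtain t where t: "perm_of t = w"
      using perm_of_surj[of w n] by (auto simp: permutations_of_set_def)
    have "size t = n"
      using w(1) by (metis t length_perm_of length_finite_permutations_of_set card_atLeastAtMost
        diff_Suc_1)
    then show "w \<in> perm_of ` {t \<in> Collect simsun_tree. size t = n}"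
      using w(2) t simsun_iff_hereditarily[OF w(1)] by (auto simp: simsun_tree_def)
  next
    fix w assume "w \<in> perm_of ` {t \<in> Collect simsun_tree. size t = n}"
    then obtain t where t: "simsun_tree t" "size t = n" "w = perm_of t" by auto
    then have "w \<in> permutations_of_set {1..n}" using perm_of_in_permutations[of t] by simp
    with t show "w \<in> RS n [1, 3, 2]"
      using simsun_iff_hereditarily avoids_132_perm_of[of t]
      by (auto simp: RS_def avoids_132_iff simsun_tree_def)
  qed
  then show ?thesis
    using inj_perm_of by (simp add: card_image inj_on_subset)
qed

section \<open>Generating functions\<close>

definition size_gf :: "bintree set \<Rightarrow> real fps" where
  "size_gf X = Abs_fps (\<lambda>n. real (card {t \<in> X. size t = n}))"

lemma size_gf_Un:
  assumes "X \<inter> Y = {}"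
  shows "size_gf (X \<union> Y) = size_gf X + size_gf Y"
proof -
  have fin: "finite {t \<in> X. size t = n}" for X :: "bintree set" and n
    by (rule finite_subset[OF _ finite_size_eq[of n]]) auto
  have "{t \<in> X \<union> Y. size t = n} = {t \<in> X. size t = n} \<union> {t \<in> Y. size t = n}" for n by auto
  moreover have "card ({t \<in> X. size t = n} \<union> {t \<in> Y. size t = n}) =
      card {t \<in> X. size t = n} + card {t \<in> Y. size t = n}" for n
    using assms by (intro card_Un_disjoint fin) auto
  ultimately show ?thesis
    by (simp add: size_gf_def fps_eq_iff)
qed

lemma size_gf_Leaf: "size_gf {Leaf} = 1"
proof -
  have "{t. t = Leaf \<and> size t = n} = (if n = 0 then {Leaf} else {})" for n by auto
  then show ?thesis by (simp add: size_gf_def fps_eq_iff)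
qed

lemma size_gf_Node:
  "size_gf (case_prod Node ` (X \<times> Y)) = fps_X * (size_gf X * size_gf Y)"
proof (rule fps_ext)
  fix n
  let ?X = "\<lambda>n. {t \<in> X. size t = n}" and ?Y = "\<lambda>n. {t \<in> Y. size t = n}"
  have fin: "finite {t \<in> X. size t = n}" for X :: "bintree set" and n
    by (rule finite_subset[OF _ finite_size_eq[of n]]) auto
  show "fps_nth (size_gf (case_prod Node ` (X \<times> Y))) n =
      fps_nth (fps_X * (size_gf X * size_gf Y)) n"
  proof (cases n)
    case 0
    have "{t \<in> case_prod Node ` (X \<times> Y). size t = 0} = {}" by auto
    then show ?thesis unfolding size_gf_def using 0 by (simp only: fps_nth_Abs_fps) simp
  next
    case (Suc k)
    have "{t \<in> case_prod Node ` (X \<times> Y). size t = Suc k} =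
        (\<Union>i\<in>{0..k}. case_prod Node ` (?X i \<times> ?Y (k - i)))"
      by force
    also have "card \<dots> = (\<Sum>i=0..k. card (case_prod Node ` (?X i \<times> ?Y (k - i))))"
      by (rule card_UN_disjoint) (auto simp: fin)
    also have "\<dots> = (\<Sum>i=0..k. card (?X i) * card (?Y (k - i)))"
      by (intro sum.cong refl)
        (subst card_image, auto simp: inj_on_def card_cartesian_product)
    finally show ?thesis
      unfolding Suc fps_X_mult_nth by (simp add: size_gf_def fps_mult_nth)
  qed
qed

lemma size_gf_single: "size_gf {Node Leaf Leaf} = fps_X"
  using size_gf_Node[of "{Leaf}" "{Leaf}"] by (simp add: size_gf_Leaf)

text \<open>
  In the proof, \<open>A\<close> contains the simsun trees, \<open>B\<close> those that may stand to the right of a maximum,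
  \<open>C\<close> those that may stand to the left of a maximum with something on its right, and \<open>D\<close> those that
  satisfy both conditions; \<open>E\<close> omits the single node from \<open>D\<close>, as a right part of length one creates
  a final descent. The elimination rests on the relations \<open>z c = d\<close>, \<open>e = z b\<close> and \<open>b = z a\<close>.
\<close>
lemma simsun_gf_equation:
  defines "a \<equiv> size_gf (Collect simsun_tree)"
  shows "a = 1 + (fps_X + fps_X ^ 2) * a + fps_X ^ 3 * a ^ 2"
proof -
  let ?z = "fps_X :: real fps"
  define A where "A = Collect simsun_tree"
  define B where "B = {t. t \<noteq> Leaf \<and> simsun_tree t \<and> \<not> initial_descent_tree t}"
  define C where "C = {t. simsun_tree t \<and> no_final_descent_tree t}"
  define D where "D = B \<inter> C"
  define E where "E = D - {Node Leaf Leaf}"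
  note defs = A_def B_def C_def D_def E_def
  define b c d e where "b = size_gf B" and "c = size_gf C" and "d = size_gf D" and "e = size_gf E"
  let ?N = "\<lambda>X Y. case_prod Node ` (X \<times> Y)"
  have Aeq: "A = {Leaf} \<union> (?N A {Leaf} \<union> ?N C B)"
  proof (rule set_eqI)
    fix t show "t \<in> A \<longleftrightarrow> t \<in> {Leaf} \<union> (?N A {Leaf} \<union> ?N C B)"
      by (cases t) (auto simp: defs)
  qed
  have Beq: "B = ?N {Leaf} {Leaf} \<union> (?N B {Leaf} \<union> ?N D B)"
  proof (rule set_eqI)
    fix t show "t \<in> B \<longleftrightarrow> t \<in> ?N {Leaf} {Leaf} \<union> (?N B {Leaf} \<union> ?N D B)"
      by (cases t) (auto simp: defs)
  qed
  have Ceq: "C = {Leaf} \<union> (?N C {Leaf} \<union> ?N C E)"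
  proof (rule set_eqI)
    fix t show "t \<in> C \<longleftrightarrow> t \<in> {Leaf} \<union> (?N C {Leaf} \<union> ?N C E)"
      by (cases t) (auto simp: defs)
  qed
  have Eeq: "E = ?N D {Leaf} \<union> ?N D E"
  proof (rule set_eqI)
    fix t show "t \<in> E \<longleftrightarrow> t \<in> ?N D {Leaf} \<union> ?N D E"
      by (cases t) (auto simp: defs)
  qed
  have Deq: "D = ?N {Leaf} {Leaf} \<union> E"
    by (auto simp: defs)
  note gf = size_gf_Un size_gf_Node size_gf_Leaf
  have a: "a = 1 + (?z * a + ?z * (c * b))"
    unfolding a_def A_def[symmetric] b_def c_def
    by (subst Aeq, subst size_gf_Un, force, subst size_gf_Un, force simp: defs) (simp add: gf)
  have b: "b = ?z + (?z * b + ?z * (d * b))"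
    unfolding b_def d_def
    by (subst Beq, subst size_gf_Un, force simp: defs, subst size_gf_Un, force simp: defs)
      (simp add: gf size_gf_single)
  have c: "c = 1 + (?z * c + ?z * (c * e))"
    unfolding c_def e_def
    by (subst Ceq, subst size_gf_Un, force, subst size_gf_Un, force simp: defs) (simp add: gf)
  have e: "e = ?z * d + ?z * (d * e)"
    unfolding d_def e_def
    by (subst Eeq, subst size_gf_Un, force simp: defs) (simp add: gf)
  have d: "d = ?z + e"
    unfolding d_def e_def
    by (subst Deq, subst size_gf_Un, force simp: defs) (simp add: gf size_gf_single)
  have cancel: "x = y" if "x * u = y * u" "fps_nth u 0 = 1" for x y u :: "real fps"
    using that by (metis fps_zero_nth mult_right_cancel zero_neq_one)
  \<comment> \<open>Each of the next three relations compares two solutions of one linear equation, whose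
    coefficient \<open>u\<close> has constant term 1.\<close>
  have zc: "?z * c = d"
  proof (rule cancel)
    have "c * (1 - ?z - ?z * e) = c - (?z * c + ?z * (c * e))"
      by (simp add: algebra_simps)
    also have "\<dots> = 1"
      using c by (metis add_diff_cancel_right')
    finally have "?z * c * (1 - ?z - ?z * e) = ?z"
      by (simp add: mult.assoc)
    also have "?z = d - (?z * d + ?z * (d * e))"
      unfolding e[symmetric] using d by simp
    also have "\<dots> = d * (1 - ?z - ?z * e)"
      by (simp add: algebra_simps)
    finally show "?z * c * (1 - ?z - ?z * e) = d * (1 - ?z - ?z * e)" .
  qed simp
  have eb: "e = ?z * b"
  proof (rule cancel)
    have "b * (1 - ?z - ?z * d) = b - (?z * b + ?z * (d * b))"
      by (simp add: algebra_simps)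
    also have "\<dots> = ?z"
      using b by (metis add_diff_cancel_right')
    finally have "?z * b * (1 - ?z - ?z * d) = ?z * ?z"
      by (simp add: mult.assoc)
    moreover have "e * (1 - ?z - ?z * d) = e - ?z * (d * e) - ?z * e"
      by (simp add: algebra_simps)
    moreover have "e - ?z * (d * e) = ?z * d"
      using e by (metis add_diff_cancel_right')
    moreover have "?z * d - ?z * e = ?z * ?z"
      using d by (simp add: algebra_simps)
    ultimately show "e * (1 - ?z - ?z * d) = ?z * b * (1 - ?z - ?z * d)"
      by simp
  qed simp
  have a_d: "a = 1 + (?z * a + d * b)"
    using a unfolding zc[symmetric] mult.assoc .
  have ba: "b = ?z * a"
  proof (rule cancel)
    have "?z * b = ?z * d + ?z * (d * e)"
      using e eb by simp
    also have "\<dots> = ?z * (d * (1 + e))"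
      by (simp add: algebra_simps)
    finally have "b = d * (1 + e)"
      by simp
    then have "b = (?z + ?z * b) * (1 + ?z * b)"
      using d eb by simp
    also have "\<dots> = ?z * (1 + d * b) + ?z * b"
      unfolding d eb by (simp add: algebra_simps)
    finally have "b * (1 - ?z) = ?z * (1 + d * b)"
      by (simp add: algebra_simps)
    also have "1 + d * b = 1 + (?z * a + d * b) - ?z * a"
      by simp
    also have "\<dots> = a - ?z * a"
      unfolding a_d[symmetric] ..
    also have "?z * \<dots> = ?z * a * (1 - ?z)"
      by (simp add: algebra_simps)
    finally show "b * (1 - ?z) = ?z * a * (1 - ?z)" .
  qed simp
  have "a = 1 + (?z * a + (?z + ?z * (?z * a)) * (?z * a))"
    using a_d unfolding d eb ba .
  also have "\<dots> = 1 + (?z + ?z ^ 2) * a + ?z ^ 3 * a ^ 2"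
    by (simp add: algebra_simps power2_eq_square power3_eq_cube)
  finally show ?thesis .
qed

theorem theorem3p1:
  fixes n :: nat
  shows "real (card (RS n [1, 3, 2])) = secondary_structure_number n"
proof -
  define a where "a = size_gf (Collect simsun_tree)"
  define R where "R = secondary_structure_sqrt"
  define p :: "real fps" where "p = 1 - fps_X - fps_X ^ 2"
  have "a = 1 + (fps_X + fps_X ^ 2) * a + fps_X ^ 3 * a ^ 2"
    unfolding a_def by (rule simsun_gf_equation)
  then have quad: "fps_X ^ 3 * a ^ 2 = a * p - 1"
    by (simp add: p_def algebra_simps)
  have "(p - 2 * y * a) ^ 2 = p ^ 2 - 4 * y * (a * p) + 4 * y * (y * a ^ 2)" for y
    by (simp add: power2_eq_square algebra_simps)
  then have "(p - 2 * fps_X ^ 3 * a) ^ 2 =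
      p ^ 2 - 4 * fps_X ^ 3 * (a * p) + 4 * fps_X ^ 3 * (fps_X ^ 3 * a ^ 2)" .
  also have "\<dots> = p ^ 2 - 4 * fps_X ^ 3"
    unfolding quad by (simp add: algebra_simps)
  also have "\<dots> = 1 - 2 * fps_X - fps_X ^ 2 - 2 * fps_X ^ 3 + fps_X ^ 4"
    unfolding p_def by (simp add: algebra_simps power2_eq_square power3_eq_cube power4_eq_xxxx)
  also have "\<dots> = R ^ 2"
    unfolding R_def by (rule secondary_structure_sqrt_square[symmetric])
  finally have "(p - 2 * fps_X ^ 3 * a) ^ 2 = R ^ 2" .
  then have "p - 2 * fps_X ^ 3 * a = R \<or> p - 2 * fps_X ^ 3 * a = - R"
    by (rule power2_eq_iff[THEN iffD1])
  moreover have "p - 2 * fps_X ^ 3 * a \<noteq> - R"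
  proof
    assume "p - 2 * fps_X ^ 3 * a = - R"
    then have "fps_nth (p - 2 * fps_X ^ 3 * a) 0 = fps_nth (- R) 0" by simp
    then show False by (simp add: p_def R_def)
  qed
  ultimately have "a * (2 * fps_X ^ 3) = p - R" by (simp add: algebra_simps)
  also have "\<dots> = Abs_fps secondary_structure_number * (2 * fps_X ^ 3)"
    using secondary_structure_gf by (simp add: p_def R_def)
  finally have "a = Abs_fps secondary_structure_number" by simp
  then have "fps_nth a n = secondary_structure_number n" by simp
  then show ?thesis unfolding card_RS_132 by (simp add: a_def size_gf_def)
qed

end
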